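(* Let $\mathcal{G}=(G,\ell_M)$ be a simple directed time-varying graph on finitely many (ordered) vertices with $\ell_M(v)=\mathbb{R}$ for every vertex $v$, so that its matrix of lifetimes satisfies $M=I+A$, where $A$ is the adjacency matrix of $\mathcal{G}$. Then for each edge $[i,j]$ of $G$ (so $i\neq j$) there is a chain of subsets of $\mathbb{R}$ \[ M^0_{ij}=\varnothing\subseteq M^1_{ij}\subseteq\cdots\subseteq M^k_{ij}\subseteq\cdots, \] where $M^k_{ij}$ denotes the $(i,j)$ entry of the matrix power $M^k$, and $M^k_{ij}$ is the union of the lifetimes of all walks in $G$ from $i$ to $j$ of length $k$ or less. Moreover, the lifetime curve \[ L(M^\bullet)(i,j):\mathbb{N}\to[0,\infty],\qquad k\mapsto \mu(M^k_{ij}), \] where $\mu$ is Lebesgue measure (so $\mu(M^k_{ij})$ is the sum of the lengths of the intervals in entry $(i,j)$ of $M^k$), is well defined and non-decreasing, and it takes only finite values provided all off-diagonal entries of $M$ have finite measure.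
   Context: Lifetimes: $\mathcal{L}(\mathbb{R})$ is the set of subsets of $\mathbb{R}$ that are finite (possibly empty) unions of disjoint closed intervals (possibly degenerate or unbounded). It is a semi-ring with addition $\cup$ (neutral element $\varnothing$) and multiplication $\cap$ (neutral element $\mathbb{R}$). Matrices over it are added entrywise and multiplied by $(MN)_{ij}=\bigcup_k M_{ik}\cap N_{kj}$; the identity matrix $I$ has $\mathbb{R}$ on the diagonal and $\varnothing$ elsewhere, and $M^0=I$. A simple directed time-varying graph $(G,\ell_M)$ is a simple directed graph $G$ (at most one directed edge from one vertex to another, no loops) with a lifetime $\ell_M(x)\in\mathcal{L}(\mathbb{R})$ for each vertex and edge $x$, such that $\ell_M(e)\subseteq\ell_M(v)$ whenever $v$ is an endpoint of $e$. Its lifetime matrix $M$ has $M_{ij}=\ell_M(i,j)$ if $(i,j)$ is an edge, $M_{ij}=\varnothing$ if $i\neq j$ and $(i,j)$ is not an edge, and $M_{ii}=\ell_M(i)$; the adjacency matrix $A$ agrees with $M$ off the diagonal and has $A_{ii}=\varnothing$. The lifetime of a walk $[v_0,\dots,v_k]$ in $G$ (consecutive vertices joined by directed edges; length $k$) is $\ell_M(v_0,v_1)\cap\cdots\cap\ell_M(v_{k-1},v_k)$ for $k\ge1$, and is $\ell_M(v_0)$ for $k=0$. *)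

theory Defs
  imports
    "HOL-Analysis.Analysis"
    "Jordan_Normal_Form.Matrix"
    "Graph_Theory.Pair_Digraph"
    "Graph_Theory.Vertex_Walk"
begin

section \<open>The semi-ring of lifetimes\<close>

definition closed_interval :: "real set \<Rightarrow> bool" where
  "closed_interval J \<longleftrightarrow> J \<noteq> {} \<and> is_interval J \<and> closed J"

definition interval_length :: "real set \<Rightarrow> ennreal" where
  "interval_length J = (if bounded J then ennreal (Sup J - Inf J) else \<infinity>)"

definition interval_decomposition :: "real set set \<Rightarrow> real set \<Rightarrow> bool" where
  "interval_decomposition \<C> S \<longleftrightarrow>
     finite \<C> \<and> disjoint \<C> \<and> (\<forall>J\<in>\<C>. closed_interval J) \<and> S = \<Union>\<C>"

lemma interval_decomposition_UnionI:
  assumes fin: "finite \<D>" and ci: "\<And>J. J \<in> \<D> \<Longrightarrow> is_interval J \<and> closed J"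
  shows "\<exists>\<C>. interval_decomposition \<C> (\<Union>\<D>)"
proof -
  define S where "S = \<Union>\<D>"
  have clS: "closed S"
    unfolding S_def using fin ci by (intro closed_Union) auto
  have "components S \<subseteq> (\<lambda>J. connected_component_set S (SOME x. x \<in> J)) ` \<D>"
  proof
    fix K assume "K \<in> components S"
    then obtain x where x: "x \<in> S" "K = connected_component_set S x"
      by (auto simp: components_def)
    then obtain J where J: "J \<in> \<D>" "x \<in> J" by (auto simp: S_def)
    have y: "(SOME x. x \<in> J) \<in> J" using J(2) by (rule someI)
    have "Topological_Spaces.connected J" using ci[OF J(1)] by (simp add: is_interval_connected_1)
    moreover have "J \<subseteq> S" using J(1) by (auto simp: S_def)
    ultimately have "connected_component S x (SOME x. x \<in> J)"
      using J(2) y unfolding connected_component_def by blast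
    then have "K = connected_component_set S (SOME x. x \<in> J)"
      using x(2) by (simp add: connected_component_eq)
    then show "K \<in> (\<lambda>J. connected_component_set S (SOME x. x \<in> J)) ` \<D>"
      using J(1) by blast
  qed
  then have "finite (components S)" using fin by (meson finite_imageI finite_subset)
  moreover have "disjoint (components S)"
    by (auto simp: disjoint_def components_nonoverlap)
  moreover have "closed_interval K" if "K \<in> components S" for K
    using that clS
    by (auto simp: closed_interval_def is_interval_connected_1 closed_components
        in_components_connected in_components_nonempty)
  ultimately have "interval_decomposition (components S) S"
    by (auto simp: interval_decomposition_def)
  then show ?thesis by (auto simp: S_def)
qed

typedef lifetime = "{S :: real set. \<exists>\<C>. interval_decomposition \<C> S}"
  morphisms lifetime_set Lifetime
proof -
  have "interval_decomposition {} {}" by (auto simp: interval_decomposition_def)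
  then show ?thesis by blast
qed

lemma lifetime_UNIV: "\<exists>\<C>. interval_decomposition \<C> UNIV"
  using interval_decomposition_UnionI[of "{UNIV}"] by simp

lemma lifetime_Un:
  assumes "\<exists>\<C>. interval_decomposition \<C> S" and "\<exists>\<C>. interval_decomposition \<C> T"
  shows "\<exists>\<C>. interval_decomposition \<C> (S \<union> T)"
proof -
  obtain \<A> \<B> where "interval_decomposition \<A> S" "interval_decomposition \<B> T"
    using assms by blast
  then show ?thesis
    using interval_decomposition_UnionI[of "\<A> \<union> \<B>"]
    by (auto simp: interval_decomposition_def closed_interval_def)
qed

lemma lifetime_Int:
  assumes "\<exists>\<C>. interval_decomposition \<C> S" and "\<exists>\<C>. interval_decomposition \<C> T"
  shows "\<exists>\<C>. interval_decomposition \<C> (S \<inter> T)"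
proof -
  obtain \<A> \<B> where *: "interval_decomposition \<A> S" "interval_decomposition \<B> T"
    using assms by blast
  define \<D> where "\<D> = (\<lambda>(J, K). J \<inter> K) ` (\<A> \<times> \<B>)"
  have "S \<inter> T = \<Union>\<D>" using * by (fastforce simp: \<D>_def interval_decomposition_def)
  moreover have "finite \<D>" using * by (auto simp: \<D>_def interval_decomposition_def)
  moreover have "is_interval J \<and> closed J" if "J \<in> \<D>" for J
    using that *
    by (auto simp: \<D>_def interval_decomposition_def closed_interval_def
        intro: is_interval_Int closed_Int)
  ultimately show ?thesis using interval_decomposition_UnionI by metis
qed

setup_lifting type_definition_lifetime

instantiation lifetime :: comm_semiring_1
begin

lift_definition zero_lifetime :: lifetime is "{}"
  by (rule exI[of _ "{}"]) (simp add: interval_decomposition_def)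

lift_definition one_lifetime :: lifetime is "UNIV"
  by (rule lifetime_UNIV)

lift_definition plus_lifetime :: "lifetime \<Rightarrow> lifetime \<Rightarrow> lifetime" is "(\<union>)"
  by (rule lifetime_Un)

lift_definition times_lifetime :: "lifetime \<Rightarrow> lifetime \<Rightarrow> lifetime" is "(\<inter>)"
  by (rule lifetime_Int)

instance by standard (transfer; auto)+

end

section \<open>Simple directed time-varying graphs\<close>

text \<open>
  The edges of a \<open>pair_digraph\<close> are ordered pairs of distinct vertices, hence there
  are no loops and no multiple edges. The lifetime function is given by its restriction
  \<open>lvert\<close> to vertices and its restriction \<open>ledge\<close> to edges; their values elsewhere are
  irrelevant. The list \<open>vs\<close> is the chosen ordering of the vertices, so row and column
  index \<open>i\<close> of a matrix stands for the vertex \<open>vs ! i\<close>.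
\<close>

locale simple_tvg = pair_digraph G for G :: "'v pair_pre_digraph" +
  fixes lvert :: "'v \<Rightarrow> lifetime" and ledge :: "'v \<times> 'v \<Rightarrow> lifetime" and vs :: "'v list"
  assumes distinct_vs: "distinct vs"
    and set_vs: "set vs = pverts G"
    and lifetime_edge_subset: "(u, v) \<in> parcs G \<Longrightarrow>
      lifetime_set (ledge (u, v)) \<subseteq> lifetime_set (lvert u) \<and>
      lifetime_set (ledge (u, v)) \<subseteq> lifetime_set (lvert v)"

definition lifetime_matrix ::
  "'v pair_pre_digraph \<Rightarrow> ('v \<Rightarrow> lifetime) \<Rightarrow> ('v \<times> 'v \<Rightarrow> lifetime) \<Rightarrow> 'v list \<Rightarrow> lifetime mat"
  where
  "lifetime_matrix G lvert ledge vs = mat (length vs) (length vs) (\<lambda>(i, j).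
     if i = j then lvert (vs ! i)
     else if (vs ! i, vs ! j) \<in> parcs G then ledge (vs ! i, vs ! j)
     else 0)"

definition adjacency_matrix ::
  "'v pair_pre_digraph \<Rightarrow> ('v \<times> 'v \<Rightarrow> lifetime) \<Rightarrow> 'v list \<Rightarrow> lifetime mat"
  where
  "adjacency_matrix G ledge vs = mat (length vs) (length vs) (\<lambda>(i, j).
     if i \<noteq> j \<and> (vs ! i, vs ! j) \<in> parcs G then ledge (vs ! i, vs ! j) else 0)"

definition walk_lifetime ::
  "('v \<Rightarrow> lifetime) \<Rightarrow> ('v \<times> 'v \<Rightarrow> lifetime) \<Rightarrow> 'v vwalk \<Rightarrow> real set"
  where
  "walk_lifetime lvert ledge p =
     (if vwalk_length p = 0 then lifetime_set (lvert (hd p))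
      else (\<Inter>e\<in>set (vwalk_arcs p). lifetime_set (ledge e)))"

definition walks_upto :: "'v pair_pre_digraph \<Rightarrow> 'v \<Rightarrow> 'v \<Rightarrow> nat \<Rightarrow> 'v vwalk set" where
  "walks_upto G u v k =
     {p. vwalk p (with_proj G) \<and> hd p = u \<and> last p = v \<and> vwalk_length p \<le> k}"

definition lifetime_curve :: "lifetime mat \<Rightarrow> nat \<Rightarrow> nat \<Rightarrow> nat \<Rightarrow> ennreal" where
  "lifetime_curve M i j k = emeasure lebesgue (lifetime_set ((M ^\<^sub>m k) $$ (i, j)))"

end

theory Submission
  imports Defs
begin

text \<open>
  Since every diagonal entry of \<open>M\<close> is \<open>\<real>\<close>, the expansion
  \<open>M\<^sup>k\<^sup>+\<^sup>1(i, j) = (\<Union>l. M\<^sup>k(i, l) \<inter> M(l, j))\<close> has the term \<open>M\<^sup>k(i, j)\<close> at \<open>l = j\<close>, which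
  yields the chain; the terms \<open>l \<noteq> j\<close> append one edge to a walk, and they lie in
  \<open>M(l, j)\<close>, so that they preserve finiteness of the measure.
\<close>

section \<open>Sums and matrix products of lifetimes as sets of reals\<close>

lemma lifetime_set_sum:
  "finite S \<Longrightarrow> lifetime_set (\<Sum>a\<in>S. f a) = (\<Union>a\<in>S. lifetime_set (f a))"
  by (induction S rule: finite_induct) (simp_all add: zero_lifetime.rep_eq plus_lifetime.rep_eq)

lemma lifetime_set_mult_mat:
  assumes "A \<in> carrier_mat m n" "B \<in> carrier_mat n q" "i < m" "j < q"
  shows "lifetime_set ((A * B) $$ (i, j)) =
    (\<Union>l<n. lifetime_set (A $$ (i, l)) \<inter> lifetime_set (B $$ (l, j)))"
  using assms
  by (auto simp: scalar_prod_def lifetime_set_sum times_lifetime.rep_eq)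

section \<open>Lebesgue measure of closed intervals and of lifetimes\<close>

lemma emeasure_closed_interval:
  assumes "closed_interval J"
  shows "emeasure lebesgue J = interval_length J"
proof -
  have ne: "J \<noteq> {}" and int: "is_interval J" and cl: "closed J"
    using assms by (auto simp: closed_interval_def)
  \<comment> \<open>A closed set is Borel, so its measure can be computed in \<open>lborel\<close>
    instead of the completion \<open>lebesgue\<close>.\<close>
  have J: "J \<in> sets lborel" using cl by simp
  show ?thesis
  proof (cases "bounded J")
    case True
    then have "compact J" using cl by (simp add: compact_eq_bounded_closed)
    then obtain a b where ab: "J = {a..b}"
      using int connected_compact_interval_1 is_interval_connected_1 by metis
    with ne True show ?thesis
      by (simp add: interval_length_def cl)
  next
    case False
    obtain c where c: "c \<in> J" using ne by blast
    \<comment> \<open>An unbounded \<open>J\<close> has points farther than \<open>n\<close> from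
      the fixed \<open>c\<close>, and by convexity it contains the whole segment between
      \<open>c\<close> and such a point.\<close>
    have le: "ennreal (real n) \<le> emeasure lborel J" for n
    proof -
      obtain y where y: "y \<in> J" "\<bar>y - c\<bar> > real n"
        using False c unfolding bounded_any_center[of J c] dist_real_def
        by (metis abs_minus_commute not_le)
      have "{min c y..max c y} \<subseteq> J"
        using mem_is_interval_1_I[OF int c y(1)] mem_is_interval_1_I[OF int y(1) c]
        by (cases "c \<le> y") (auto simp: min_def max_def)
      then have "emeasure lborel {min c y..max c y} \<le> emeasure lborel J"
        using J by (rule emeasure_mono)
      moreover have "ennreal (real n) \<le> emeasure lborel {min c y..max c y}"
        using y(2) by (cases "c \<le> y") (simp_all add: min_def max_def)
      ultimately show ?thesis by (rule order_trans[rotated])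
    qed
    have "emeasure lborel J = \<infinity>"
    proof (rule ccontr)
      assume "emeasure lborel J \<noteq> \<infinity>"
      then obtain r where r: "0 \<le> r" "emeasure lborel J = ennreal r"
        by (cases "emeasure lborel J") auto
      obtain n :: nat where "r < real n" using reals_Archimedean2 by blast
      moreover have "real n \<le> r" using le[of n] r by simp
      ultimately show False by simp
    qed
    with False show ?thesis by (simp add: interval_length_def cl)
  qed
qed

lemma interval_decomposition_closed: "interval_decomposition \<C> S \<Longrightarrow> closed S"
  by (auto simp: interval_decomposition_def closed_interval_def)

text \<open>Finite additivity of the measure. As the left-hand side does not mention \<C>, the sum
  of lengths is the same for every decomposition; this is what makes the lifetime curve well
  defined.\<close>

lemma emeasure_interval_decomposition:
  assumes "interval_decomposition \<C> S"
  shows "emeasure lebesgue S = (\<Sum>J\<in>\<C>. interval_length J)"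
proof -
  have ci: "closed_interval J" if "J \<in> \<C>" for J
    using that assms by (simp add: interval_decomposition_def)
  have "(\<Sum>J\<in>\<C>. emeasure lebesgue J) = emeasure lebesgue (\<Union>J\<in>\<C>. J)"
  proof (rule sum_emeasure)
    show "(\<lambda>J. J) ` \<C> \<subseteq> sets lebesgue"
      using ci by (auto simp: closed_interval_def)
    show "disjoint_family_on (\<lambda>J. J) \<C>"
      using assms by (auto simp: interval_decomposition_def disjoint_family_on_def disjoint_def)
    show "finite \<C>" using assms by (simp add: interval_decomposition_def)
  qed
  then show ?thesis
    using assms ci by (simp add: interval_decomposition_def emeasure_closed_interval)
qed

lemma lifetime_set_decomposition: "\<exists>\<C>. interval_decomposition \<C> (lifetime_set t)"
  using lifetime_set by blast

lemma lifetime_set_closed: "closed (lifetime_set t)"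
  using lifetime_set_decomposition interval_decomposition_closed by blast

lemma lifetime_set_lebesgue: "lifetime_set t \<in> sets lebesgue"
  using lifetime_set_closed[of t] by simp

section \<open>Powers of the lifetime matrix when all vertices are always alive\<close>

locale always_alive_tvg = simple_tvg +
  assumes always_alive: "v \<in> pverts G \<Longrightarrow> lifetime_set (lvert v) = UNIV"
begin

abbreviation "M \<equiv> lifetime_matrix G lvert ledge vs"

lemma M_carrier: "M \<in> carrier_mat (length vs) (length vs)"
  by (simp add: lifetime_matrix_def)

lemma pow_carrier: "M ^\<^sub>m k \<in> carrier_mat (length vs) (length vs)"
  using M_carrier by simp

lemma nth_pverts: "i < length vs \<Longrightarrow> vs ! i \<in> pverts G"
  using set_vs nth_mem by blast

lemma M_diag: "i < length vs \<Longrightarrow> lifetime_set (M $$ (i, i)) = UNIV"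
  by (simp add: lifetime_matrix_def always_alive nth_pverts)

lemma M_edge:
  "i < length vs \<Longrightarrow> j < length vs \<Longrightarrow> (vs ! i, vs ! j) \<in> parcs G \<Longrightarrow>
    M $$ (i, j) = ledge (vs ! i, vs ! j)"
  using pair_no_loops[of "(vs ! i, vs ! j)"] by (auto simp: lifetime_matrix_def)

lemma in_M_offdiag:
  assumes "i < length vs" "j < length vs" "i \<noteq> j" "x \<in> lifetime_set (M $$ (i, j))"
  shows "(vs ! i, vs ! j) \<in> parcs G" "x \<in> lifetime_set (ledge (vs ! i, vs ! j))"
  using assms by (auto simp: lifetime_matrix_def zero_lifetime.rep_eq split: if_splits)

lemma M_eq: "M = 1\<^sub>m (length vs) + adjacency_matrix G ledge vs"
proof -
  have "lvert v = 1" if "v \<in> pverts G" for v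
    using always_alive[OF that] by (simp add: lifetime_set_inject[symmetric] one_lifetime.rep_eq)
  then show ?thesis
    by (intro eq_matI) (auto simp: lifetime_matrix_def adjacency_matrix_def nth_pverts)
qed

lemma pow_Suc_entry:
  assumes "i < length vs" "j < length vs"
  shows "lifetime_set ((M ^\<^sub>m Suc k) $$ (i, j)) =
    (\<Union>l<length vs. lifetime_set ((M ^\<^sub>m k) $$ (i, l)) \<inter> lifetime_set (M $$ (l, j)))"
  using lifetime_set_mult_mat[OF pow_carrier M_carrier assms] by simp

lemma pow_entry_mono:
  assumes "i < length vs" "j < length vs"
  shows "lifetime_set ((M ^\<^sub>m k) $$ (i, j)) \<subseteq> lifetime_set ((M ^\<^sub>m Suc k) $$ (i, j))"
  unfolding pow_Suc_entry[OF assms] using M_diag[OF assms(2)] assms(2) by blast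

section \<open>Entries of matrix powers as unions over walks\<close>

text \<open>A walk of length 0 has no arcs, and the empty intersection \<open>UNIV\<close> is also
  the lifetime of its vertex. The case distinction in \<open>walk_lifetime\<close> thus
  disappears.\<close>

lemma walk_lifetime_eq:
  assumes "vwalk p (with_proj G)"
  shows "walk_lifetime lvert ledge p = (\<Inter>e\<in>set (vwalk_arcs p). lifetime_set (ledge e))"
proof (cases "vwalk_length p = 0")
  case True
  with assms obtain v where "p = [v]" "v \<in> pverts G"
    by (cases p) (auto simp: vwalk_def)
  then show ?thesis by (simp add: walk_lifetime_def always_alive)
qed (simp add: walk_lifetime_def)

lemma vwalk_snoc_iff:
  assumes "p \<noteq> []"
  shows "vwalk (p @ [v]) (with_proj G) \<longleftrightarrow> vwalk p (with_proj G) \<and> (last p, v) \<in> parcs G"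
  using assms by (auto simp: vwalk_def vwalk_arcs_append dest: in_arcsD2)

text \<open>Mirrors one term of the matrix product \<open>M ^\<^sub>m k * M\<close>. It also covers
  a single vertex \<open>p\<close>, whose lifetime is neutral for intersection.\<close>

lemma walk_lifetime_snoc:
  assumes "vwalk (p @ [v]) (with_proj G)" "p \<noteq> []"
  shows "walk_lifetime lvert ledge (p @ [v]) =
    walk_lifetime lvert ledge p \<inter> lifetime_set (ledge (last p, v))"
  using assms by (auto simp: vwalk_snoc_iff walk_lifetime_eq vwalk_arcs_append)

text \<open>Stated for all pairs of indices, not only for edges: the induction splits off the last
  step, so the hypothesis is needed at an arbitrary penultimate vertex, which may be
  \<open>vs ! i\<close> itself.\<close>

lemma pow_entry_walks:
  assumes "i < length vs" "j < length vs"
  shows "lifetime_set ((M ^\<^sub>m k) $$ (i, j)) =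
    (\<Union>p \<in> walks_upto G (vs ! i) (vs ! j) k. walk_lifetime lvert ledge p)"
  using assms(2)
proof (induction k arbitrary: j)
  case 0
  have dim: "dim_row M = length vs" by (simp add: lifetime_matrix_def)
  \<comment> \<open>Equality of end vertices becomes equality of indices because \<open>vs\<close>
    is distinct.\<close>
  have walks: "walks_upto G (vs ! i) (vs ! j) 0 = (if i = j then {[vs ! i]} else {})"
  proof (rule Set.set_eqI)
    fix p show "p \<in> walks_upto G (vs ! i) (vs ! j) 0 \<longleftrightarrow>
        p \<in> (if i = j then {[vs ! i]} else {})"
      using assms(1) 0 nth_pverts[OF assms(1)] nth_eq_iff_index_eq[OF distinct_vs, of i j]
      by (cases p) (auto simp: walks_upto_def vwalk_def)
  qed
  show ?case
    using assms(1) 0 always_alive[OF nth_pverts[OF 0]] unfolding walks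
    by (simp add: dim one_lifetime.rep_eq zero_lifetime.rep_eq walk_lifetime_def)
next
  case (Suc k)
  show ?case
  proof (intro equalityI subsetI)
    fix x assume "x \<in> lifetime_set ((M ^\<^sub>m Suc k) $$ (i, j))"
    then obtain l where l: "l < length vs" "x \<in> lifetime_set ((M ^\<^sub>m k) $$ (i, l))"
        "x \<in> lifetime_set (M $$ (l, j))"
      unfolding pow_Suc_entry[OF assms(1) Suc.prems] by blast
    obtain p where p: "p \<in> walks_upto G (vs ! i) (vs ! l) k" "x \<in> walk_lifetime lvert ledge p"
      using l(2) Suc.IH[OF l(1)] by blast
    show "x \<in> (\<Union>p \<in> walks_upto G (vs ! i) (vs ! j) (Suc k). walk_lifetime lvert ledge p)"
    proof (cases "l = j")
      \<comment> \<open>The diagonal term adds no edge: the same walk is still short enough for the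
        larger bound.\<close>
      case True
      then have "p \<in> walks_upto G (vs ! i) (vs ! j) (Suc k)"
        using p(1) by (auto simp: walks_upto_def)
      then show ?thesis using p(2) by blast
    next
      case False
      \<comment> \<open>An off-diagonal entry containing \<open>x\<close> is nonempty, hence comes
        from an edge, which can be appended to \<open>p\<close>.\<close>
      note edge = in_M_offdiag[OF l(1) Suc.prems False l(3)]
      have ne: "p \<noteq> []" and last: "last p = vs ! l" and w: "vwalk p (with_proj G)"
        using p(1) by (auto simp: walks_upto_def vwalk_def)
      have w': "vwalk (p @ [vs ! j]) (with_proj G)"
        using ne last w edge(1) by (simp add: vwalk_snoc_iff)
      have "p @ [vs ! j] \<in> walks_upto G (vs ! i) (vs ! j) (Suc k)"
        using p(1) ne w' by (auto simp: walks_upto_def)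
      moreover have "x \<in> walk_lifetime lvert ledge (p @ [vs ! j])"
        using walk_lifetime_snoc[OF w' ne] p(2) edge(2) last by simp
      ultimately show ?thesis by blast
    qed
  next
    fix x assume "x \<in> (\<Union>p \<in> walks_upto G (vs ! i) (vs ! j) (Suc k). walk_lifetime lvert ledge p)"
    then obtain p where p: "p \<in> walks_upto G (vs ! i) (vs ! j) (Suc k)"
        "x \<in> walk_lifetime lvert ledge p" by blast
    show "x \<in> lifetime_set ((M ^\<^sub>m Suc k) $$ (i, j))"
    proof (cases "vwalk_length p \<le> k")
      case True
      then have "p \<in> walks_upto G (vs ! i) (vs ! j) k"
        using p(1) by (auto simp: walks_upto_def)
      then show ?thesis
        using p(2) Suc.IH[OF Suc.prems] pow_entry_mono[OF assms(1) Suc.prems] by blast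
    next
      case False
      \<comment> \<open>The walk has exactly \<open>Suc k\<close> edges, so one vertex more than
        that; at least one edge can be split off at its end.\<close>
      then have len: "length p = Suc (Suc k)" using p(1) by (auto simp: walks_upto_def)
      then have "p = butlast p @ [vs ! j]" "butlast p \<noteq> []"
        using p(1) append_butlast_last_id[of p]
        by (auto simp: walks_upto_def simp flip: length_greater_0_conv)
      then obtain q where q: "p = q @ [vs ! j]" "q \<noteq> []" by blast
      have w: "vwalk (q @ [vs ! j]) (with_proj G)" using p(1) q(1) by (simp add: walks_upto_def)
      then have wq: "vwalk q (with_proj G)" and edge: "(last q, vs ! j) \<in> parcs G"
        using q(2) by (simp_all add: vwalk_snoc_iff)
      obtain l where l: "l < length vs" "vs ! l = last q"
        using in_arcsD1[OF edge] set_vs by (metis in_set_conv_nth)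
      have "q \<in> walks_upto G (vs ! i) (vs ! l) k"
        using p(1) q wq l(2) len by (auto simp: walks_upto_def)
      moreover have "x \<in> walk_lifetime lvert ledge q" "x \<in> lifetime_set (M $$ (l, j))"
        using p(2) q walk_lifetime_snoc[OF w q(2)] M_edge[OF l(1) Suc.prems] l(2) edge by auto
      ultimately show ?thesis
        unfolding pow_Suc_entry[OF assms(1) Suc.prems] using l(1) Suc.IH[OF l(1)] by blast
    qed
  qed
qed

section \<open>Monotonicity and finiteness of the lifetime curve\<close>

lemma lifetime_curve_mono:
  assumes "i < length vs" "j < length vs"
  shows "mono (lifetime_curve M i j)"
  unfolding mono_iff_le_Suc lifetime_curve_def
  using pow_entry_mono[OF assms] by (blast intro: emeasure_mono lifetime_set_lebesgue)

text \<open>Off the diagonal the curve starts at measure 0, and each step adds only points of the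
  other entries in column \<open>j\<close> of \<open>M\<close>. With \<open>i = j\<close> the claim
  would fail, as the entry is then all of \<open>UNIV\<close>.\<close>

lemma lifetime_curve_finite:
  assumes fin: "\<And>a b. a < length vs \<Longrightarrow> b < length vs \<Longrightarrow> a \<noteq> b \<Longrightarrow>
      emeasure lebesgue (lifetime_set (M $$ (a, b))) < \<infinity>"
    and ij: "i < length vs" "j < length vs" "i \<noteq> j"
  shows "lifetime_curve M i j k < \<infinity>"
proof (induction k)
  case 0
  have "dim_row M = length vs" by (simp add: lifetime_matrix_def)
  with ij show ?case by (simp add: lifetime_curve_def zero_lifetime.rep_eq)
next
  case (Suc k)
  let ?U = "lifetime_set ((M ^\<^sub>m k) $$ (i, j))"
  \<comment> \<open>The index \<open>j\<close> is left out because \<open>M $$ (j, j)\<close> has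
    infinite measure; its term in the product is contained in \<open>?U\<close>.\<close>
  let ?V = "\<Union>l\<in>{..<length vs} - {j}. lifetime_set (M $$ (l, j))"
  have V: "?V \<in> fmeasurable lebesgue"
    using fin ij by (intro fmeasurable.finite_UN) (auto intro!: fmeasurableI lifetime_set_lebesgue)
  have U: "?U \<in> fmeasurable lebesgue"
    using Suc by (auto simp: lifetime_curve_def intro!: fmeasurableI lifetime_set_lebesgue)
  have "lifetime_set ((M ^\<^sub>m Suc k) $$ (i, j)) \<subseteq> ?U \<union> ?V"
    unfolding pow_Suc_entry[OF ij(1,2)] by blast
  moreover have UV: "?U \<union> ?V \<in> fmeasurable lebesgue"
    using U V by (rule fmeasurable.Un)
  ultimately have "lifetime_curve M i j (Suc k) \<le> emeasure lebesgue (?U \<union> ?V)"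
    unfolding lifetime_curve_def by (blast intro: emeasure_mono fmeasurableD)
  also have "\<dots> < \<infinity>" using fmeasurableD2[OF UV] by (simp add: less_top)
  finally show ?case .
qed

end

theorem lemma2p22:
  fixes G :: "'v pair_pre_digraph"
    and lvert :: "'v \<Rightarrow> lifetime" and ledge :: "'v \<times> 'v \<Rightarrow> lifetime" and vs :: "'v list"
    and M A :: "lifetime mat"
  assumes tvg: "simple_tvg G lvert ledge vs"
    and always_alive: "\<And>v. v \<in> pverts G \<Longrightarrow> lifetime_set (lvert v) = UNIV"
    and M: "M = lifetime_matrix G lvert ledge vs"
    and A: "A = adjacency_matrix G ledge vs"
  shows "M = 1\<^sub>m (length vs) + A \<and>
    (\<forall>i < length vs. \<forall>j < length vs. (vs ! i, vs ! j) \<in> parcs G \<longrightarrow>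
      lifetime_set ((M ^\<^sub>m 0) $$ (i, j)) = {} \<and>
      (\<forall>k. lifetime_set ((M ^\<^sub>m k) $$ (i, j)) \<subseteq> lifetime_set ((M ^\<^sub>m Suc k) $$ (i, j))) \<and>
      (\<forall>k. lifetime_set ((M ^\<^sub>m k) $$ (i, j)) =
        (\<Union>p \<in> walks_upto G (vs ! i) (vs ! j) k. walk_lifetime lvert ledge p)) \<and>
      (\<forall>k. lifetime_set ((M ^\<^sub>m k) $$ (i, j)) \<in> sets lebesgue \<and>
        (\<exists>\<C>. interval_decomposition \<C> (lifetime_set ((M ^\<^sub>m k) $$ (i, j)))) \<and>
        (\<forall>\<C>. interval_decomposition \<C> (lifetime_set ((M ^\<^sub>m k) $$ (i, j))) \<longrightarrow>
          lifetime_curve M i j k = (\<Sum>J\<in>\<C>. interval_length J))) \<and>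
      mono (lifetime_curve M i j) \<and>
      ((\<forall>a < length vs. \<forall>b < length vs. a \<noteq> b \<longrightarrow>
          emeasure lebesgue (lifetime_set (M $$ (a, b))) < \<infinity>) \<longrightarrow>
        (\<forall>k. lifetime_curve M i j k < \<infinity>)))"
proof -
  interpret always_alive_tvg G lvert ledge vs
    using tvg always_alive by (intro always_alive_tvg.intro always_alive_tvg_axioms.intro)
  show ?thesis
  proof (intro conjI allI impI)
    show "M = 1\<^sub>m (length vs) + A" unfolding M A by (rule M_eq)
  next
    fix i j k
    assume ij: "i < length vs" "j < length vs" and edge: "(vs ! i, vs ! j) \<in> parcs G"
    \<comment> \<open>The absence of loops places the entry off the diagonal, as needed both for the
      empty start of the chain and for finiteness.\<close>
    have "i \<noteq> j" using pair_no_loops[OF edge] by auto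
    then show "lifetime_set ((M ^\<^sub>m 0) $$ (i, j)) = {}"
      using ij by (simp add: M lifetime_matrix_def zero_lifetime.rep_eq)
    show "lifetime_set ((M ^\<^sub>m k) $$ (i, j)) \<subseteq> lifetime_set ((M ^\<^sub>m Suc k) $$ (i, j))"
      unfolding M using ij by (rule pow_entry_mono)
    show "lifetime_set ((M ^\<^sub>m k) $$ (i, j)) =
        (\<Union>p \<in> walks_upto G (vs ! i) (vs ! j) k. walk_lifetime lvert ledge p)"
      unfolding M using ij by (rule pow_entry_walks)
    show "lifetime_set ((M ^\<^sub>m k) $$ (i, j)) \<in> sets lebesgue"
      by (rule lifetime_set_lebesgue)
    show "\<exists>\<C>. interval_decomposition \<C> (lifetime_set ((M ^\<^sub>m k) $$ (i, j)))"
      by (rule lifetime_set_decomposition)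
    show "mono (lifetime_curve M i j)"
      unfolding M using ij by (rule lifetime_curve_mono)
    show "lifetime_curve M i j k = (\<Sum>J\<in>\<C>. interval_length J)"
      if "interval_decomposition \<C> (lifetime_set ((M ^\<^sub>m k) $$ (i, j)))" for \<C>
      unfolding lifetime_curve_def using that by (rule emeasure_interval_decomposition)
    show "lifetime_curve M i j k < \<infinity>"
      if "\<forall>a < length vs. \<forall>b < length vs. a \<noteq> b \<longrightarrow>
          emeasure lebesgue (lifetime_set (M $$ (a, b))) < \<infinity>"
      using that ij \<open>i \<noteq> j\<close> unfolding M by (intro lifetime_curve_finite) auto
  qed
qed

end
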